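(* Let $q$ be a prime power, let $\lambda \in \mathbb{F}_{q^n}\setminus\mathbb{F}_q$, $t = [\mathbb{F}_q(\lambda):\mathbb{F}_q]$, let $\overline{S}$ be an $\mathbb{F}_{q^t}$-subspace of $\mathbb{F}_{q^n}$ of $\mathbb{F}_{q^t}$-dimension $l>0$, $b \in \mathbb{F}_{q^n}^*$ with $\mathbb{F}_{q^t}\cap b\overline{S}=\{0\}$, $0<m<t$, $k = tl+m$ with $t+1 \le k \le n$, and $S = \overline{S} \oplus b\langle 1, \lambda, \ldots, \lambda^{m-1}\rangle_{\mathbb{F}_q}$, with $Y=\langle S\rangle_{\mathbb{F}_{q^t}} = \mathbb{F}_{q^n}$ and $2m \ge t-1$. Suppose $\mathcal{C}=\mathrm{Orb}(S)$ is an $r$-FWS code with $r = 2m+t(l-1)$, and that $r = tl$ (i.e. $2m = t$). Then \[ \omega_{2i}(\mathcal{C}) = \begin{cases} (q + 1)q^{2i-1}, & \text{if } i \in \{1, \ldots, m - 1\}, \\ \frac{q^n - q^{2m-1}}{q - 1}, & \text{if } i = m. \end{cases} \]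
   Context: $\mathrm{Orb}(S)=\{\alpha S:\alpha\in\mathbb{F}_{q^n}^*\}$; $d(U,V)=2k-2\dim_{\mathbb{F}_q}(U\cap V)$; the weight distribution is $\omega_{2i}(\mathcal{C})=|\{\alpha S: \alpha\in\mathbb{F}_{q^n}^*, d(S,\alpha S)=2i\}|$ for $i=1,\dots,k$. $\mathcal{C}$ is an $r$-FWS code if $\omega_{2i}=0$ for $i=k-r+1,\ldots,k$ and $\omega_{2i}\neq 0$ for all $i=1,\ldots,k-r$. $\langle S\rangle_{\mathbb{F}_{q^t}}$ denotes the $\mathbb{F}_{q^t}$-span of $S$. *)

theory Defs
  imports "HOL-Algebra.Algebra"
begin

definition scale_set :: "('a, 'b) ring_scheme \<Rightarrow> 'a \<Rightarrow> 'a set \<Rightarrow> 'a set" where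
  "scale_set R a A = (\<lambda>x. a \<otimes>\<^bsub>R\<^esub> x) ` A"

definition sum_set :: "('a, 'b) ring_scheme \<Rightarrow> 'a set \<Rightarrow> 'a set \<Rightarrow> 'a set" where
  "sum_set R A B = {x \<oplus>\<^bsub>R\<^esub> y | x y. x \<in> A \<and> y \<in> B}"

definition span_set :: "('a, 'b) ring_scheme \<Rightarrow> 'a set \<Rightarrow> 'a set \<Rightarrow> 'a set" where
  "span_set R K A = \<Inter> {V. subalgebra K V R \<and> A \<subseteq> V}"

definition Orb :: "('a, 'b) ring_scheme \<Rightarrow> 'a set \<Rightarrow> 'a set set" where
  "Orb R S = {scale_set R \<alpha> S | \<alpha>. \<alpha> \<in> carrier R - {\<zero>\<^bsub>R\<^esub>}}"

definition subspace_dist :: "('a, 'b) ring_scheme \<Rightarrow> 'a set \<Rightarrow> 'a set \<Rightarrow> 'a set \<Rightarrow> nat" where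
  "subspace_dist R F U V = 2 * ring.dim R F U - 2 * ring.dim R F (U \<inter> V)"

definition omega :: "('a, 'b) ring_scheme \<Rightarrow> 'a set \<Rightarrow> 'a set \<Rightarrow> nat \<Rightarrow> nat" where
  "omega R F S i = card {V \<in> Orb R S. subspace_dist R F S V = 2 * i}"

definition is_FWS :: "('a, 'b) ring_scheme \<Rightarrow> 'a set \<Rightarrow> 'a set \<Rightarrow> nat \<Rightarrow> bool" where
  "is_FWS R F S r \<longleftrightarrow>
     (let k = ring.dim R F S in
       (\<forall>i \<in> {k - r + 1 .. k}. omega R F S i = 0) \<and>
       (\<forall>i \<in> {1 .. k - r}. omega R F S i \<noteq> 0))"

end

theory Submission
  imports Defs
begin

text \<open>
  Write $K = F(\lambda)$, let $P_j \subseteq K$ consist of the polynomials of degree less than $j$ in $\lambda$, and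
  let $W_j(\alpha) = P_j \cap \alpha^{-1} P_j$. Since $r = tl$ forces $t = 2m$, products of two elements of
  $P_m$ have a unique expansion in powers of $\lambda$.

  The span condition makes $\overline{S}$ a $K$-hyperplane. If $\alpha \in K$, then
  $S \cap \alpha S = \overline{S} \oplus b(P_m \cap \alpha P_m)$; otherwise $\alpha$ moves the hyperplane, so
  $S + \alpha S$ is everything. In both cases $|S \cap \alpha S| = |\overline{S}| \cdot |W_m(\alpha)|$. Moreover the
  stabiliser of $S$ is $F^*$, so every member of the orbit arises from $q - 1$ scalars, and only the
  distribution of $|W_m(\alpha)|$ is needed.

  Comparing leading coefficients shows that $\dim W_j(\alpha)$ is $0$ up to some index and then grows
  by one at each step, so it suffices to count the $\alpha$ with $W_j(\alpha) \neq 0$. Counting pairs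
  $(u, \alpha u)$ gives $\sum_\alpha (|W_j(\alpha)| - 1) = (q^j - 1)^2$. Subtracting $q$ times this identity for
  $j$ from the one for $j + 1$ leaves $q - 1$ for each $\alpha$ with $W_{j+1}(\alpha) \neq 0$, and there are
  therefore $q^{2j+1} - 1$ of these.
\<close>

section \<open>Subspaces of a finite field\<close>

context field
begin

section \<open>Closure rules for subspaces and subfields\<close>

lemma subalgebra_facts:
  assumes "subalgebra K V R"
  shows "V \<subseteq> carrier R" "\<zero> \<in> V"
    "\<And>u v. u \<in> V \<Longrightarrow> v \<in> V \<Longrightarrow> u \<oplus> v \<in> V"
    "\<And>u. u \<in> V \<Longrightarrow> \<ominus> u \<in> V"
    "\<And>u v. u \<in> V \<Longrightarrow> v \<in> V \<Longrightarrow> u \<ominus> v \<in> V"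
    "\<And>c v. c \<in> K \<Longrightarrow> v \<in> V \<Longrightarrow> c \<otimes> v \<in> V"
proof -
  interpret V: subalgebra K V R by fact
  show "V \<subseteq> carrier R" "\<zero> \<in> V" using V.subset V.one_closed by auto
  show add: "u \<oplus> v \<in> V" if "u \<in> V" "v \<in> V" for u v using V.m_closed[OF that] by simp
  show neg: "\<ominus> u \<in> V" if "u \<in> V" for u using V.m_inv_closed[OF that] by (simp add: a_inv_def)
  show "u \<ominus> v \<in> V" if "u \<in> V" "v \<in> V" for u v
    using add neg that by (simp add: a_minus_def)
  show "c \<otimes> v \<in> V" if "c \<in> K" "v \<in> V" for c v using V.smult_closed that by blast
qed

text \<open>Additive inverses come from scaling by \<open>\<ominus> \<one>\<close>, so addition and
  scaling are all that has to be checked.\<close>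

lemma subalgebraI:
  assumes "V \<subseteq> carrier R" "\<zero> \<in> V" "K \<subseteq> carrier R" "\<ominus> \<one> \<in> K"
    and "\<And>u v. u \<in> V \<Longrightarrow> v \<in> V \<Longrightarrow> u \<oplus> v \<in> V"
    and "\<And>c v. c \<in> K \<Longrightarrow> v \<in> V \<Longrightarrow> c \<otimes> v \<in> V"
  shows "subalgebra K V R"
proof (rule subalgebra.intro)
  show "subgroup V (add_monoid R)"
  proof (rule add.subgroupI)
    fix u assume u: "u \<in> V"
    have "\<ominus> \<one> \<otimes> u \<in> V" using assms u by blast
    then show "\<ominus> u \<in> V" using u assms(1) l_minus[of \<one> u] by auto
  qed (use assms in auto)
  show "subalgebra_axioms K V R" using assms by (simp add: subalgebra_axioms_def)
qed

lemma subfield_facts: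
  assumes "subfield K R"
  shows "K \<subseteq> carrier R" "\<zero> \<in> K" "\<one> \<in> K" "\<ominus> \<one> \<in> K"
    "\<And>u v. u \<in> K \<Longrightarrow> v \<in> K \<Longrightarrow> u \<oplus> v \<in> K"
    "\<And>u. u \<in> K \<Longrightarrow> \<ominus> u \<in> K"
    "\<And>u v. u \<in> K \<Longrightarrow> v \<in> K \<Longrightarrow> u \<ominus> v \<in> K"
    "\<And>u v. u \<in> K \<Longrightarrow> v \<in> K \<Longrightarrow> u \<otimes> v \<in> K"
    "\<And>u. u \<in> K \<Longrightarrow> u \<noteq> \<zero> \<Longrightarrow> inv u \<in> K"
  using subringE[OF subfieldE(1)[OF assms]] subfield_m_inv(1)[OF assms]
  by (auto simp: a_minus_def)

lemma subfield_subalgebra: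
  assumes "subfield K R"
  shows "subalgebra K K R"
  using subfield_facts[OF assms] by (intro subalgebraI) auto

lemma nonzero_inv:
  assumes "u \<in> carrier R" "u \<noteq> \<zero>"
  shows "inv u \<in> carrier R" "inv u \<noteq> \<zero>" "u \<otimes> inv u = \<one>" "inv u \<otimes> u = \<one>"
  using subfield_m_inv[OF carrier_is_subfield, of u] assms by auto

section \<open>Adjoining one vector to a subspace\<close>

lemma line_extension_subalgebra:
  assumes K: "subfield K R" and V: "subalgebra K V R" and v: "v \<in> carrier R"
  shows "subalgebra K (line_extension K v V) R"
proof -
  note K' = subfield_facts[OF K] and V' = subalgebra_facts[OF V]
  have mem: "k \<otimes> v \<oplus> u \<in> line_extension K v V" if "k \<in> K" "u \<in> V" for k u
    using that by (auto simp: line_extension_mem_iff)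
  show ?thesis
  proof (rule subalgebraI)
    show "line_extension K v V \<subseteq> carrier R"
      using line_extension_in_carrier[OF K'(1) v V'(1)] .
    show "\<zero> \<in> line_extension K v V" using mem[OF K'(2) V'(2)] v by simp
  next
    fix a c assume "a \<in> line_extension K v V" "c \<in> line_extension K v V"
    then obtain k u k' u' where *: "k \<in> K" "u \<in> V" "k' \<in> K" "u' \<in> V"
      and ac: "a = k \<otimes> v \<oplus> u" "c = k' \<otimes> v \<oplus> u'"
      by (auto simp: line_extension_mem_iff)
    have c: "k \<in> carrier R" "u \<in> carrier R" "k' \<in> carrier R" "u' \<in> carrier R"
      using * K'(1) V'(1) by auto
    have "a \<oplus> c = (k \<oplus> k') \<otimes> v \<oplus> (u \<oplus> u')"
      unfolding ac using c v by (simp add: l_distr a_ac)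
    then show "a \<oplus> c \<in> line_extension K v V"
      using mem[OF K'(5)[OF *(1,3)] V'(3)[OF *(2,4)]] by simp
  next
    fix a c assume "c \<in> K" "a \<in> line_extension K v V"
    then obtain k u where *: "k \<in> K" "u \<in> V" "c \<in> K" and a: "a = k \<otimes> v \<oplus> u"
      by (auto simp: line_extension_mem_iff)
    have c: "k \<in> carrier R" "u \<in> carrier R" "c \<in> carrier R" using * K'(1) V'(1) by auto
    have "c \<otimes> a = (c \<otimes> k) \<otimes> v \<oplus> (c \<otimes> u)"
      unfolding a using c v by (simp add: r_distr m_assoc)
    then show "c \<otimes> a \<in> line_extension K v V"
      using mem[OF K'(8)[OF *(3,1)] V'(6)[OF *(3,2)]] by simp
  qed (use K'(1,4) in auto)
qed

text \<open>Different coefficients would put a nonzero multiple of \<open>v\<close> into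
  \<open>V\<close>, and dividing by that multiple would put \<open>v\<close> itself there.\<close>

lemma line_coeff_unique:
  assumes K: "subfield K R" and V: "subalgebra K V R" and v: "v \<in> carrier R" "v \<notin> V"
    and k: "k \<in> K" "k' \<in> K" and u: "u \<in> V" "u' \<in> V"
    and eq: "k \<otimes> v \<oplus> u = k' \<otimes> v \<oplus> u'"
  shows "k = k'" "u = u'"
proof -
  note K' = subfield_facts[OF K] and V' = subalgebra_facts[OF V]
  have c: "k \<in> carrier R" "u \<in> carrier R" "k' \<in> carrier R" "u' \<in> carrier R"
    using k u K'(1) V'(1) by auto
  let ?d = "k \<ominus> k'"
  have "?d \<otimes> v = (k \<otimes> v \<oplus> u) \<ominus> (k' \<otimes> v) \<ominus> u" using c v(1) by algebra
  also have "\<dots> = u' \<ominus> u" unfolding eq using c v(1) by algebra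
  finally have mem: "?d \<otimes> v \<in> V" using V'(5)[OF u(2,1)] by simp
  show "k = k'"
  proof (rule ccontr)
    assume "k \<noteq> k'"
    then have d: "?d \<in> K - {\<zero>}" using k K'(7) c by (simp add: r_right_minus_eq)
    have ic: "inv ?d \<in> carrier R" "inv ?d \<otimes> ?d = \<one>" "inv ?d \<in> K"
      using subfield_m_inv[OF K d] K'(1) by auto
    have "inv ?d \<otimes> (?d \<otimes> v) = v"
      using ic v(1) c by (simp add: m_assoc[symmetric])
    then show False using V'(6)[OF ic(3) mem] v(2) by simp
  qed
  then show "u = u'" using eq c v by simp
qed

lemma card_line_extension:
  assumes K: "subfield K R" and V: "subalgebra K V R" and v: "v \<in> carrier R" "v \<notin> V"
  shows "card (line_extension K v V) = card K * card V"
proof -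
  have "inj_on (\<lambda>(k, u). k \<otimes> v \<oplus> u) (K \<times> V)"
    using line_coeff_unique[OF assms] by (auto simp: inj_on_def)
  moreover have "(\<lambda>(k, u). k \<otimes> v \<oplus> u) ` (K \<times> V) = line_extension K v V"
    by (force simp: line_extension_mem_iff)
  ultimately have "bij_betw (\<lambda>(k, u). k \<otimes> v \<oplus> u) (K \<times> V) (line_extension K v V)"
    by (rule bij_betw_imageI)
  then show ?thesis by (metis bij_betw_same_card card_cartesian_product)
qed

lemma dimension_subalgebra:
  assumes K: "subfield K R" and "dimension n K E"
  shows "subalgebra K E R"
  using finite_dimension_imp_subalgebra[OF K finite_dimensionI[OF assms(2)]] .

lemma card_dimension:
  assumes "dimension n K E" and "subfield K R"
  shows "card E = card K ^ n"
  using assms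
proof (induction rule: dimension.induct)
  case (Suc_dim v E n K)
  then show ?case
    using card_line_extension[OF Suc_dim.prems dimension_subalgebra[OF Suc_dim.prems Suc_dim.hyps(3)]]
    by simp
qed simp

end

locale finite_field = field R for R (structure) +
  assumes finite_carrier: "finite (carrier R)"
begin

section \<open>Cardinality versus dimension over a finite field\<close>

lemma finite_subalgebra: "subalgebra K V R \<Longrightarrow> finite V"
  using subalgebra_facts(1) finite_carrier finite_subset by blast

lemma finite_subfield: "subfield K R \<Longrightarrow> finite K"
  using subfield_facts(1) finite_carrier finite_subset by blast

lemma card_subfield_ge_2:
  assumes "subfield K R"
  shows "2 \<le> card K"
proof -
  have "card {\<zero>, \<one>} \<le> card K"
    using subfield_facts[OF assms] finite_subfield[OF assms] by (intro card_mono) auto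
  then show ?thesis by simp
qed

lemma subalgebra_finite_dimension:
  assumes K: "subfield K R" and V: "subalgebra K V R"
  shows "finite_dimension K V"
proof -
  \<comment> \<open>The whole finite carrier serves as a spanning list.\<close>
  obtain Us where Us: "set Us = carrier R" using finite_list[OF finite_carrier] by blast
  show ?thesis
    using subalbegra_incl_imp_finite_dimension[OF K Span_finite_dimension[OF K, of Us] V]
      Span_base_incl[OF K, of Us] Us subalgebra_facts(1)[OF V] by auto
qed

lemma card_subalgebra:
  assumes K: "subfield K R" and V: "subalgebra K V R"
  shows "card V = card K ^ dim K V"
  using card_dimension[OF finite_dimensionE[OF K subalgebra_finite_dimension[OF assms]] K]
  by (simp add: over_def)

text \<open>The counting below works with cardinalities; this converts them back into the dimensions
  in which distances are defined. The exponent is determined because the base is at least 2.\<close>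

lemma dim_eqI:
  assumes K: "subfield K R" and V: "subalgebra K V R" and "card V = card K ^ d"
  shows "dim K V = d"
proof -
  have "card K ^ dim K V = card K ^ d" using card_subalgebra[OF K V] assms(3) by simp
  then show ?thesis using card_subfield_ge_2[OF K] by simp
qed

text \<open>The dimension formula for a sum of two subspaces, exponentiated.\<close>

lemma card_Int_set_add:
  assumes K: "subfield K R" and A: "subalgebra K A R" and B: "subalgebra K B R"
  shows "card A * card B = card (A <+>\<^bsub>R\<^esub> B) * card (A \<inter> B)"
proof -
  note fA = subalgebra_finite_dimension[OF K A] and fB = subalgebra_finite_dimension[OF K B]
  have AB: "subalgebra K (A \<inter> B) R" by (rule subalgebra_inter[OF A B])
  \<comment> \<open>The dimension formula subtracts natural numbers; this bound makes that
    subtraction exact.\<close>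
  have "card (A \<inter> B) \<le> card A" by (intro card_mono finite_subalgebra[OF A]) auto
  then have le: "dim K (A \<inter> B) \<le> dim K A"
    using card_subfield_ge_2[OF K] by (simp add: card_subalgebra[OF K] A AB)
  have S: "subalgebra K (A <+>\<^bsub>R\<^esub> B) R"
    by (rule finite_dimension_imp_subalgebra[OF K sum_space_dim(1)[OF K fA fB]])
  show ?thesis
    using sum_space_dim(2)[OF K fA fB] le
    by (simp add: over_def card_subalgebra[OF K] A B AB S flip: power_add)
qed

section \<open>Scaled copies of a subspace and their orbit\<close>

lemma inj_on_mult:
  assumes "a \<in> carrier R" "a \<noteq> \<zero>" "A \<subseteq> carrier R"
  shows "inj_on ((\<otimes>) a) A"
proof (rule inj_onI)
  fix x y assume "x \<in> A" "y \<in> A" "a \<otimes> x = a \<otimes> y"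
  then show "x = y" using m_lcancel[of a x y] assms by auto
qed

text \<open>An injective self-map of a finite set is onto. This is what later allows division by
  \<open>a\<close> inside \<open>A\<close>.\<close>

lemma scale_set_eq:
  assumes "A \<subseteq> carrier R" "a \<in> carrier R" "a \<noteq> \<zero>" "scale_set R a A \<subseteq> A"
  shows "scale_set R a A = A"
  unfolding scale_set_def
proof (rule endo_inj_surj)
  show "finite A" using assms(1) finite_carrier finite_subset by blast
  show "(\<otimes>) a ` A \<subseteq> A" using assms(4) unfolding scale_set_def .
  show "inj_on ((\<otimes>) a) A" using assms by (intro inj_on_mult)
qed

lemma scale_set_subalgebra:
  assumes K: "subfield K R" and A: "subalgebra K A R" and a: "a \<in> carrier R"
  shows "subalgebra K (scale_set R a A) R"
proof -
  note K' = subfield_facts[OF K] and A' = subalgebra_facts[OF A]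
  have mem: "a \<otimes> x \<in> scale_set R a A" if "x \<in> A" for x
    using that by (simp add: scale_set_def)
  show ?thesis
  proof (rule subalgebraI)
    show "scale_set R a A \<subseteq> carrier R" using A'(1) a by (auto simp: scale_set_def)
    show "\<zero> \<in> scale_set R a A" using mem[OF A'(2)] a by simp
  next
    fix u v assume "u \<in> scale_set R a A" "v \<in> scale_set R a A"
    then obtain x y where xy: "x \<in> A" "y \<in> A" "u = a \<otimes> x" "v = a \<otimes> y" unfolding scale_set_def by blast
    then have "u \<oplus> v = a \<otimes> (x \<oplus> y)" using A'(1) a by (simp add: r_distr subset_iff)
    then show "u \<oplus> v \<in> scale_set R a A" using mem[OF A'(3)[OF xy(1,2)]] by simp
  next
    fix c v assume "c \<in> K" "v \<in> scale_set R a A"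
    then obtain x where x: "c \<in> K" "x \<in> A" "v = a \<otimes> x" unfolding scale_set_def by blast
    then have "c \<otimes> v = a \<otimes> (c \<otimes> x)" using A'(1) K'(1) a by (simp add: m_lcomm subset_iff)
    then show "c \<otimes> v \<in> scale_set R a A" using mem[OF A'(6)[OF x(1,2)]] by simp
  qed (use K'(1,4) in auto)
qed

lemma card_scale_set:
  assumes "A \<subseteq> carrier R" "a \<in> carrier R" "a \<noteq> \<zero>"
  shows "card (scale_set R a A) = card A"
  unfolding scale_set_def
  using assms by (intro card_image inj_on_mult)

lemma scale_set_scale_set:
  assumes "A \<subseteq> carrier R" "a \<in> carrier R" "c \<in> carrier R"
  shows "scale_set R a (scale_set R c A) = scale_set R (a \<otimes> c) A"
  unfolding scale_set_def image_image using assms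
  by (intro image_cong) (auto simp: m_assoc subset_iff)

text \<open>Orbit-stabiliser counting: the scalars producing a given member of the orbit form a
  coset of the multiplicative group of \<open>F\<close>.\<close>

lemma card_orbit_fibres:
  assumes F: "subfield F R" and S: "S \<subseteq> carrier R"
    and stab: "\<And>a. a \<in> carrier R - {\<zero>} \<Longrightarrow> scale_set R a S = S \<longleftrightarrow> a \<in> F"
  shows "card {a \<in> carrier R - {\<zero>}. Q (scale_set R a S)}
    = (card F - 1) * card {V \<in> Orb R S. Q V}"
proof -
  let ?A = "{a \<in> carrier R - {\<zero>}. Q (scale_set R a S)}"
  let ?f = "\<lambda>a. scale_set R a S"
  note F' = subfield_facts[OF F]
  have img: "?f ` ?A = {V \<in> Orb R S. Q V}"
    unfolding Orb_def by blast
  have fib: "card {a \<in> ?A. ?f a = V} = card F - 1" if V: "V \<in> ?f ` ?A" for V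
  proof -
    obtain c where c: "c \<in> carrier R" "c \<noteq> \<zero>" and QV: "Q V" and Vc: "V = ?f c"
      using V by blast
    have ic: "inv c \<in> carrier R" "inv c \<noteq> \<zero>" "inv c \<otimes> c = \<one>" "c \<otimes> inv c = \<one>"
      using nonzero_inv c by auto
    \<comment> \<open>Cancelling the injective scaling by \<open>c\<close> reduces equality with
      \<open>V\<close> to membership of \<open>inv c \<otimes> a\<close> in the stabiliser.\<close>
    have iff: "?f a = V \<longleftrightarrow> inv c \<otimes> a \<in> F" if a: "a \<in> carrier R" "a \<noteq> \<zero>" for a
    proof -
      let ?d = "inv c \<otimes> a"
      have d: "?d \<in> carrier R - {\<zero>}" using integral[of "inv c" a] a ic by auto
      have ca: "c \<otimes> ?d = a" using a c ic by (simp add: m_assoc[symmetric])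
      have "?f a = scale_set R c (?f ?d)"
        using S a c d ca by (subst scale_set_scale_set) auto
      moreover have "?f ?d \<subseteq> carrier R"
        using S d unfolding scale_set_def by auto
      ultimately have "?f a = V \<longleftrightarrow> ?f ?d = S"
        unfolding Vc scale_set_def[of R c]
        using inj_on_image_eq_iff[OF inj_on_mult[OF c, of "carrier R"]] S by simp
      then show ?thesis using stab[OF d] by simp
    qed
    have "{a \<in> ?A. ?f a = V} = (\<otimes>) c ` (F - {\<zero>})"
    proof (intro equalityI subsetI)
      fix a assume "a \<in> {a \<in> ?A. ?f a = V}"
      then have a: "a \<in> carrier R" "a \<noteq> \<zero>" "inv c \<otimes> a \<in> F" using iff by auto
      have "a = c \<otimes> (inv c \<otimes> a)" using a c ic by (simp add: m_assoc[symmetric])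
      moreover have "inv c \<otimes> a \<noteq> \<zero>" using integral[of "inv c" a] a ic by auto
      ultimately show "a \<in> (\<otimes>) c ` (F - {\<zero>})" using a(3) by blast
    next
      fix a assume "a \<in> (\<otimes>) c ` (F - {\<zero>})"
      then obtain f where f: "f \<in> F" "f \<noteq> \<zero>" "a = c \<otimes> f" by blast
      then have fc: "f \<in> carrier R" using F'(1) by blast
      have a: "a \<in> carrier R" "a \<noteq> \<zero>" using f fc c integral[of c f] by auto
      moreover have "inv c \<otimes> a = f" using f fc c ic by (simp add: m_assoc[symmetric])
      ultimately have "?f a = V" using iff f by auto
      then show "a \<in> {a \<in> ?A. ?f a = V}" using a QV by auto
    qed
    moreover have "inj_on ((\<otimes>) c) (F - {\<zero>})" using c F'(1) by (intro inj_on_mult) auto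
    ultimately have "card {a \<in> ?A. ?f a = V} = card (F - {\<zero>})" by (simp add: card_image)
    then show ?thesis using F'(2) finite_subfield[OF F] by simp
  qed
  have "finite ?A" using finite_carrier by simp
  \<comment> \<open>Count the scalars fibre by fibre; all fibres have the same size.\<close>
  then have "card ?A = (\<Sum>V \<in> ?f ` ?A. card {a \<in> ?A. ?f a = V})"
    using sum.image_gen[of ?A "\<lambda>_. 1::nat" ?f] by simp
  also have "\<dots> = (\<Sum>V \<in> ?f ` ?A. card F - 1)"
    by (rule sum.cong[OF refl fib])
  finally show ?thesis unfolding img by simp
qed

end

section \<open>Polynomials of bounded degree in a generator\<close>

locale finite_simple_extension = finite_field +
  fixes F x
  assumes subF: "subfield F R" and x: "x \<in> carrier R"
begin

abbreviation K where "K \<equiv> generate_field R (insert x F)"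

definition P where "P j = Span F (map (\<lambda>i. x [^] i) [0..<j])"

definition W where "W a j = {u \<in> P j. a \<otimes> u \<in> P j}"

lemmas F = subfield_facts[OF subF]

lemma q_ge_2: "2 \<le> card F"
  by (rule card_subfield_ge_2[OF subF])

lemma subK: "subfield K R"
  using x F(1) by (intro generate_field_is_subfield) auto

lemma F_subset_K: "F \<subseteq> K" and x_in_K: "x \<in> K"
  by (auto intro: generate_field.incl)

lemma subalgebra_K_imp_F: "subalgebra K V R \<Longrightarrow> subalgebra F V R"
  using F_subset_K by (auto simp: subalgebra_def subalgebra_axioms_def)

section \<open>Subspaces stable under the generator\<close>

text \<open>Induction on how the elements of \<open>K\<close> are generated from \<open>x\<close>
  and \<open>F\<close>. Only inverses need an argument beyond closure, and there finiteness of
  \<open>V\<close> decides.\<close>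

lemma stable_imp_K_closed:
  assumes V: "subalgebra F V R" and xV: "\<And>v. v \<in> V \<Longrightarrow> x \<otimes> v \<in> V"
    and a: "a \<in> K" and v: "v \<in> V"
  shows "a \<otimes> v \<in> V"
proof -
  note V' = subalgebra_facts[OF V]
  have Kc: "a \<in> carrier R" if "a \<in> K" for a using subfield_facts(1)[OF subK] that by blast
  show ?thesis
    using a v
  proof (induction a arbitrary: v)
    case one
    then show ?case using V'(1) by auto
  next
    case (incl h)
    then show ?case using xV V'(6) by auto
  next
    case (a_inv h)
    then show ?case using V'(1) V'(4) Kc l_minus[of h v] by auto
  next
    case (m_inv h)
    have h: "h \<in> carrier R" "h \<noteq> \<zero>" using m_inv.hyps Kc by auto
    have ih: "inv h \<in> carrier R" "inv h \<otimes> h = \<one>"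
      using nonzero_inv h by auto
    \<comment> \<open>Multiplication by \<open>h\<close> maps \<open>V\<close> into itself, hence
      onto itself, so \<open>v\<close> can be divided by \<open>h\<close> without leaving
      \<open>V\<close>.\<close>
    have "scale_set R h V \<subseteq> V" using m_inv.IH unfolding scale_set_def by blast
    then have "v \<in> scale_set R h V" using scale_set_eq[OF V'(1) h] m_inv.prems by simp
    then obtain w where w: "w \<in> V" "v = h \<otimes> w" unfolding scale_set_def by blast
    then have "w \<in> carrier R" using V'(1) by blast
    then have "inv h \<otimes> v = w" using w h ih by (simp add: m_assoc[symmetric])
    then show ?case using w by simp
  next
    case (eng_add h1 h2)
    have c: "h1 \<in> carrier R" "h2 \<in> carrier R" "v \<in> carrier R" using eng_add V'(1) Kc by auto
    show ?case
      using V'(3)[OF eng_add.IH(1)[OF eng_add.prems] eng_add.IH(2)[OF eng_add.prems]] c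
      by (simp add: l_distr)
  next
    case (eng_mult h1 h2)
    have c: "h1 \<in> carrier R" "h2 \<in> carrier R" "v \<in> carrier R" using eng_mult V'(1) Kc by auto
    show ?case
      using eng_mult.IH(1)[OF eng_mult.IH(2)[OF eng_mult.prems]] c by (simp add: m_assoc)
  qed
qed

text \<open>With a nonzero vector \<open>v\<close>, such a space contains all of \<open>K v\<close>,
  a copy of \<open>K\<close>.\<close>

lemma card_stable_ge:
  assumes V: "subalgebra F V R" and xV: "\<And>v. v \<in> V \<Longrightarrow> x \<otimes> v \<in> V" and ne: "V \<noteq> {\<zero>}"
  shows "card K \<le> card V"
proof -
  note V' = subalgebra_facts[OF V]
  obtain v where v: "v \<in> V" "v \<noteq> \<zero>" using ne V'(2) by blast
  have vc: "v \<in> carrier R" using v V'(1) by blast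
  have Kc: "K \<subseteq> carrier R" by (rule subfield_facts(1)[OF subK])
  have "(\<lambda>a. a \<otimes> v) ` K \<subseteq> V" using stable_imp_K_closed[OF V xV] v by blast
  moreover have "inj_on (\<lambda>a. a \<otimes> v) K"
  proof (rule inj_onI)
    fix a c assume "a \<in> K" "c \<in> K" "a \<otimes> v = c \<otimes> v"
    then show "a = c" using m_rcancel[of v a c] vc v Kc by auto
  qed
  ultimately show ?thesis using card_inj_on_le[OF _ _ finite_subalgebra[OF V]] by blast
qed

section \<open>Polynomial spaces and their sizes\<close>

lemma P_0 [simp]: "P 0 = {\<zero>}"
  by (simp add: P_def)

lemma P_Suc: "P (Suc j) = line_extension F (x [^] j) (P j)"
proof -
  let ?Us = "map (\<lambda>i. x [^] i) [0..<j]"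
  \<comment> \<open>\<open>Span\<close> adjoins the head of the list last, so the newest power is
    moved to the front; reordering does not change the span.\<close>
  have "P (Suc j) = Span F (x [^] j # ?Us)"
    unfolding P_def using x by (intro Span_same_set[OF subF]) auto
  then show ?thesis by (simp add: P_def)
qed

lemma P_subalgebra: "subalgebra F (P j) R"
  unfolding P_def using x by (intro Span_is_subalgebra[OF subF]) auto

lemmas P = subalgebra_facts[OF P_subalgebra]

lemma P_closed: "u \<in> P j \<Longrightarrow> u \<in> carrier R"
  using P(1) by blast

lemma P_SucE:
  assumes "u \<in> P (Suc j)"
  obtains c p where "c \<in> F" "p \<in> P j" "u = c \<otimes> x [^] j \<oplus> p"
  using assms by (auto simp: P_Suc line_extension_mem_iff)

lemma P_SucI: "c \<in> F \<Longrightarrow> p \<in> P j \<Longrightarrow> c \<otimes> x [^] j \<oplus> p \<in> P (Suc j)"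
  by (auto simp: P_Suc line_extension_mem_iff)

lemma P_mono: "i \<le> j \<Longrightarrow> P i \<subseteq> P j"
proof (induction j rule: dec_induct)
  case (step j)
  have "p \<in> P (Suc j)" if "p \<in> P j" for p
  proof -
    have "p \<in> carrier R" using P(1) that by blast
    then show ?thesis using P_SucI[OF F(2) that] x by simp
  qed
  with step show ?case by blast
qed simp

lemma power_in_P: "x [^] j \<in> P (Suc j)"
  using P_SucI[OF F(3) P(2), of j] x by simp

lemma x_mult_P: "u \<in> P j \<Longrightarrow> x \<otimes> u \<in> P (Suc j)"
proof (induction j arbitrary: u)
  case 0
  then show ?case using P(2) x by simp
next
  case (Suc j)
  obtain c p where cp: "c \<in> F" "p \<in> P j" "u = c \<otimes> x [^] j \<oplus> p" using P_SucE[OF Suc.prems] .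
  have "c \<in> carrier R" "p \<in> carrier R" using cp F(1) P(1) by auto
  then have "x \<otimes> u = c \<otimes> x [^] Suc j \<oplus> x \<otimes> p"
    using cp x by (simp add: r_distr m_lcomm m_comm)
  then show ?case using P_SucI[OF cp(1) Suc.IH[OF cp(2)]] by simp
qed

lemma power_mult_P: "u \<in> P j \<Longrightarrow> x [^] i \<otimes> u \<in> P (i + j)"
proof (induction i)
  case 0
  then show ?case using P_closed by simp
next
  case (Suc i)
  have "u \<in> carrier R" using Suc.prems P(1) by blast
  then have "x [^] Suc i \<otimes> u = x \<otimes> (x [^] i \<otimes> u)" using x by (simp add: m_assoc m_lcomm)
  then show ?case using x_mult_P[OF Suc.IH[OF Suc.prems]] by simp
qed

lemma P_mult: "u \<in> P i \<Longrightarrow> v \<in> P j \<Longrightarrow> u \<otimes> v \<in> P (i + j)"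
proof (induction i arbitrary: u)
  case 0
  then show ?case using P_closed P(2) by simp
next
  case (Suc i)
  obtain c p where cp: "c \<in> F" "p \<in> P i" "u = c \<otimes> x [^] i \<oplus> p" using P_SucE[OF Suc.prems(1)] .
  have c: "c \<in> carrier R" "p \<in> carrier R" "v \<in> carrier R" using cp F(1) P(1) Suc.prems by auto
  have "u \<otimes> v = c \<otimes> (x [^] i \<otimes> v) \<oplus> p \<otimes> v" using cp c x by (simp add: l_distr m_assoc)
  moreover have "\<dots> \<in> P (i + j)"
    using P(3)[OF P(6)[OF cp(1) power_mult_P[OF Suc.prems(2)]] Suc.IH[OF cp(2) Suc.prems(2)]] .
  ultimately show ?case using P_mono[of "i + j" "Suc i + j"] by auto
qed

lemma P_Suc_eq:
  assumes "x [^] j \<in> P j"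
  shows "P (Suc j) = P j"
proof
  show "P (Suc j) \<subseteq> P j"
  proof
    fix u assume "u \<in> P (Suc j)"
    then obtain c p where "c \<in> F" "p \<in> P j" "u = c \<otimes> x [^] j \<oplus> p" by (rule P_SucE)
    then show "u \<in> P j" using P(3,6) assms by blast
  qed
qed (simp add: P_mono)

lemma one_in_P: "0 < j \<Longrightarrow> \<one> \<in> P j"
  using power_in_P[of 0] P_mono[of "Suc 0" j] by auto

text \<open>Holds whether or not the powers are independent: a new power either multiplies the size
  by \<open>card F\<close> or adds nothing.\<close>

lemma card_P_le: "card (P j) \<le> card F ^ j"
proof (induction j)
  case (Suc j)
  have "card (P (Suc j)) \<le> card F * card (P j)"
  proof (cases "x [^] j \<in> P j")
    case True
    then show ?thesis using q_ge_2 by (simp add: P_Suc_eq)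
  next
    case False
    then show ?thesis
      using card_line_extension[OF subF P_subalgebra] x by (simp add: P_Suc)
  qed
  also have "\<dots> \<le> card F ^ Suc j" using Suc.IH by simp
  finally show ?case .
qed simp

text \<open>If $x^j$ were in the span of the lower powers, that span would be stable under $x$, hence a
  vector space over the whole extension field, and it is too small for that.\<close>

lemma power_notin_P:
  assumes "card K = card F ^ t" "j < t"
  shows "x [^] j \<notin> P j"
proof
  assume mem: "x [^] j \<in> P j"
  \<comment> \<open>For \<open>j = 0\<close> the membership would say that \<open>\<one>\<close>
    lies in the zero space.\<close>
  have "0 < j" by (rule ccontr) (use mem in simp)
  then have "P j \<noteq> {\<zero>}" using one_in_P[of j] by auto
  moreover have "x \<otimes> u \<in> P j" if "u \<in> P j" for u
    using x_mult_P[OF that] P_Suc_eq[OF mem] by simp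
  ultimately have "card K \<le> card (P j)" by (intro card_stable_ge[OF P_subalgebra])
  also have "\<dots> \<le> card F ^ j" by (rule card_P_le)
  also have "\<dots> < card F ^ t" using assms(2) q_ge_2 by simp
  finally show False using assms(1) by simp
qed

lemma card_P:
  assumes "card K = card F ^ t"
  shows "j \<le> t \<Longrightarrow> card (P j) = card F ^ j"
proof (induction j)
  case (Suc j)
  then show ?case
    using card_line_extension[OF subF P_subalgebra _ power_notin_P[OF assms]] x by (simp add: P_Suc)
qed simp

lemma P_subset_K: "P j \<subseteq> K"
  unfolding P_def
proof (rule subalgebra_Span_incl[OF subF subalgebra_K_imp_F[OF subfield_subalgebra[OF subK]]])
  have "x [^] i \<in> K" for i :: nat
    by (induction i) (use x_in_K subfield_facts(3,8)[OF subK] in auto)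
  then show "set (map (\<lambda>i. x [^] i) [0..<j]) \<subseteq> K" by auto
qed

section \<open>The spaces \<open>W a j\<close> and their growth in \<open>j\<close>\<close>

lemma W_subalgebra: "a \<in> carrier R \<Longrightarrow> subalgebra F (W a j) R"
proof (rule subalgebraI)
  assume a: "a \<in> carrier R"
  show "W a j \<subseteq> carrier R" "\<zero> \<in> W a j" using P(1,2) a by (auto simp: W_def)
  show "u \<oplus> v \<in> W a j" if "u \<in> W a j" "v \<in> W a j" for u v
    using that a P_closed[of u j] P_closed[of v j] P(3) by (simp add: W_def r_distr)
  show "c \<otimes> v \<in> W a j" if "c \<in> F" "v \<in> W a j" for c v
  proof -
    have "a \<otimes> (c \<otimes> v) = c \<otimes> (a \<otimes> v)"
      using that a P_closed[of v j] F(1) by (auto simp: W_def m_lcomm subset_iff)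
    then show ?thesis using that P(6) by (simp add: W_def)
  qed
qed (use F(1,4) in auto)

lemma W_mono: "i \<le> j \<Longrightarrow> W a i \<subseteq> W a j"
  using P_mono unfolding W_def by blast

lemma W_0: "a \<in> carrier R \<Longrightarrow> W a 0 = {\<zero>}"
  by (auto simp: W_def)

text \<open>If $au = v$ and $au' = v'$, then $uv' = u'v$: compare the coefficients of $x^{2j}$.\<close>

lemma leading_coeffs_proportional:
  assumes a: "a \<in> carrier R" and top: "x [^] (2 * j) \<notin> P (2 * j)"
    and F4: "c \<in> F" "d \<in> F" "c' \<in> F" "d' \<in> F"
    and P4: "p \<in> P j" "r \<in> P j" "p' \<in> P j" "r' \<in> P j"
    and e: "a \<otimes> (c \<otimes> x [^] j \<oplus> p) = d \<otimes> x [^] j \<oplus> r"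
    and e': "a \<otimes> (c' \<otimes> x [^] j \<oplus> p') = d' \<otimes> x [^] j \<oplus> r'"
  shows "c \<otimes> d' = c' \<otimes> d"
proof -
  have Fc: "f \<in> carrier R" if "f \<in> F" for f using F(1) that by blast
  \<comment> \<open>Leading coefficients multiply; all other terms of the product have degree below
    \<open>2 * j\<close>.\<close>
  have prod: "\<exists>s \<in> P (2 * j). (f \<otimes> x [^] j \<oplus> p) \<otimes> (g \<otimes> x [^] j \<oplus> r) = (f \<otimes> g) \<otimes> x [^] (2 * j) \<oplus> s"
    if "f \<in> F" "g \<in> F" "p \<in> P j" "r \<in> P j" for f g p r
  proof
    have c: "f \<in> carrier R" "g \<in> carrier R" "p \<in> carrier R" "r \<in> carrier R" "x [^] j \<in> carrier R"
      using that Fc P_closed[of _ j] x by auto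
    let ?s = "f \<otimes> (x [^] j \<otimes> r) \<oplus> g \<otimes> (x [^] j \<otimes> p) \<oplus> p \<otimes> r"
    have "f \<otimes> (x [^] j \<otimes> r) \<in> P (j + j)" "g \<otimes> (x [^] j \<otimes> p) \<in> P (j + j)" "p \<otimes> r \<in> P (j + j)"
      using that P(6) power_mult_P P_mult by auto
    then show "?s \<in> P (2 * j)" using P(3) by (simp add: mult_2)
    have "x [^] (2 * j) = x [^] j \<otimes> x [^] j" using x by (simp add: nat_pow_mult mult_2)
    moreover have "(f \<otimes> y \<oplus> p) \<otimes> (g \<otimes> y \<oplus> r)
        = (f \<otimes> g) \<otimes> (y \<otimes> y) \<oplus> (f \<otimes> (y \<otimes> r) \<oplus> g \<otimes> (y \<otimes> p) \<oplus> p \<otimes> r)"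
      if "y \<in> carrier R" for y
      using c that by algebra
    ultimately show "(f \<otimes> x [^] j \<oplus> p) \<otimes> (g \<otimes> x [^] j \<oplus> r) = (f \<otimes> g) \<otimes> x [^] (2 * j) \<oplus> ?s"
      using c(5) by simp
  qed
  let ?u = "c \<otimes> x [^] j \<oplus> p" and ?u' = "c' \<otimes> x [^] j \<oplus> p'"
  have uc: "?u \<in> carrier R" "?u' \<in> carrier R" using F4 P4 Fc P_closed[of _ j] x by auto
  \<comment> \<open>Both sides equal \<open>a\<close> times \<open>?u\<close> times
    \<open>?u'\<close>.\<close>
  have "?u \<otimes> (d' \<otimes> x [^] j \<oplus> r') = ?u' \<otimes> (d \<otimes> x [^] j \<oplus> r)"
    unfolding e[symmetric] e'[symmetric] using uc a by (simp add: m_lcomm m_comm)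
  moreover obtain s where s: "s \<in> P (2 * j)"
    "?u \<otimes> (d' \<otimes> x [^] j \<oplus> r') = (c \<otimes> d') \<otimes> x [^] (2 * j) \<oplus> s"
    using prod F4 P4 by blast
  moreover obtain s' where s': "s' \<in> P (2 * j)"
    "?u' \<otimes> (d \<otimes> x [^] j \<oplus> r) = (c' \<otimes> d) \<otimes> x [^] (2 * j) \<oplus> s'"
    using prod F4 P4 by blast
  ultimately have "(c \<otimes> d') \<otimes> x [^] (2 * j) \<oplus> s = (c' \<otimes> d) \<otimes> x [^] (2 * j) \<oplus> s'" by simp
  then show ?thesis
    using line_coeff_unique(1)[OF subF P_subalgebra _ top F(8) F(8) s(1) s'(1)] F4 x by simp
qed

text \<open>It grows at most by this factor because leading coefficients are proportional, and it grows
  because otherwise \<open>W a j\<close> would be stable under \<open>x\<close>.\<close>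

lemma card_W_Suc:
  assumes a: "a \<in> carrier R" and t: "card K = card F ^ t" "2 * j < t"
    and ne: "W a (Suc j) \<noteq> {\<zero>}"
  shows "card (W a (Suc j)) = card F * card (W a j)"
proof -
  note WS = W_subalgebra[OF a]
  note W' = subalgebra_facts[OF WS]
  have top: "x [^] (2 * j) \<notin> P (2 * j)" by (rule power_notin_P[OF t])
  have "\<not> W a (Suc j) \<subseteq> W a j"
  proof
    assume "W a (Suc j) \<subseteq> W a j"
    then have eq: "W a (Suc j) = W a j" using W_mono[of j "Suc j"] by auto
    have "x \<otimes> u \<in> W a j" if "u \<in> W a j" for u
    proof -
      have "a \<otimes> (x \<otimes> u) = x \<otimes> (a \<otimes> u)" using that a x P_closed[of u j] by (simp add: W_def m_lcomm)
      then have "x \<otimes> u \<in> W a (Suc j)" using that x_mult_P by (simp add: W_def)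
      then show ?thesis using eq by simp
    qed
    \<comment> \<open>A nonzero stable space has at least \<open>card F ^ t\<close> elements, while
      \<open>W a j\<close> lies inside \<open>P j\<close>, which has at most
      \<open>card F ^ j\<close>.\<close>
    then have "card K \<le> card (W a j)"
      using ne eq by (intro card_stable_ge[OF WS]) auto
    also have "\<dots> \<le> card (P j)"
      by (intro card_mono finite_subalgebra[OF P_subalgebra]) (auto simp: W_def)
    also have "\<dots> \<le> card F ^ j" by (rule card_P_le)
    also have "\<dots> < card F ^ t" using t(2) q_ge_2 by simp
    finally show False using t by simp
  qed
  then obtain u0 where u0: "u0 \<in> W a (Suc j)" "u0 \<notin> W a j" by blast
  have u0c: "u0 \<in> carrier R" using u0 W'(1) by blast
  obtain c0 p0 where u0_eq: "c0 \<in> F" "p0 \<in> P j" "u0 = c0 \<otimes> x [^] j \<oplus> p0"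
    using u0(1) P_SucE unfolding W_def by blast
  obtain d0 r0 where v0_eq: "d0 \<in> F" "r0 \<in> P j" "a \<otimes> u0 = d0 \<otimes> x [^] j \<oplus> r0"
    using u0(1) P_SucE unfolding W_def by blast
  have Fc: "f \<in> carrier R" if "f \<in> F" for f using F(1) that by blast
  \<comment> \<open>If both leading coefficients vanished, \<open>u0\<close> would already lie in
    \<open>W a j\<close>.\<close>
  have lead: "c0 \<noteq> \<zero> \<or> d0 \<noteq> \<zero>"
    using u0(2) u0_eq v0_eq x P_closed[OF u0_eq(2)] P_closed[OF v0_eq(2)] by (auto simp: W_def)
  have "W a (Suc j) = line_extension F u0 (W a j)"
  proof
    show "line_extension F u0 (W a j) \<subseteq> W a (Suc j)"
      using u0(1) subalgebra_facts(3,6)[OF WS[of "Suc j"]] subsetD[OF W_mono[of j "Suc j" a]]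
      by (auto simp: line_extension_mem_iff)
    show "W a (Suc j) \<subseteq> line_extension F u0 (W a j)"
    proof
      fix u assume u: "u \<in> W a (Suc j)"
      have uc: "u \<in> carrier R" using u W'(1) by blast
      obtain c p where u_eq: "c \<in> F" "p \<in> P j" "u = c \<otimes> x [^] j \<oplus> p"
        using u P_SucE unfolding W_def by blast
      obtain d r where v_eq: "d \<in> F" "r \<in> P j" "a \<otimes> u = d \<otimes> x [^] j \<oplus> r"
        using u P_SucE unfolding W_def by blast
      have cross: "c0 \<otimes> d = c \<otimes> d0"
        using leading_coeffs_proportional[OF a top u0_eq(1) v0_eq(1) u_eq(1) v_eq(1) u0_eq(2)
            v0_eq(2) u_eq(2) v_eq(2)] u0_eq(3) v0_eq(3) u_eq(3) v_eq(3) by simp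
      \<comment> \<open>By \<open>cross\<close> the pairs (\<open>c\<close>, \<open>d\<close>) and
        (\<open>c0\<close>, \<open>d0\<close>) are proportional; the factor is the quotient at a
        nonzero entry of the second pair.\<close>
      have "\<exists>s \<in> F. c = s \<otimes> c0 \<and> d = s \<otimes> d0"
      proof (cases "c0 = \<zero>")
        case False
        have i: "inv c0 \<in> F" "inv c0 \<otimes> c0 = \<one>" "c0 \<otimes> inv c0 = \<one>"
          using subfield_m_inv[OF subF, of c0] False u0_eq by auto
        have "c = (c \<otimes> inv c0) \<otimes> c0" using i u0_eq u_eq Fc by (simp add: m_assoc)
        moreover have "d = (c \<otimes> inv c0) \<otimes> d0"
        proof -
          have "(c \<otimes> inv c0) \<otimes> d0 = inv c0 \<otimes> (c0 \<otimes> d)"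
            unfolding cross using i u_eq v0_eq Fc by (simp add: m_assoc m_lcomm)
          then show ?thesis using i u0_eq v_eq Fc by (simp add: m_assoc[symmetric])
        qed
        ultimately show ?thesis using F(8)[OF u_eq(1) i(1)] by blast
      next
        case True
        then have d0: "d0 \<noteq> \<zero>" using lead by blast
        have i: "inv d0 \<in> F" "inv d0 \<otimes> d0 = \<one>" "d0 \<otimes> inv d0 = \<one>"
          using subfield_m_inv[OF subF, of d0] d0 v0_eq by auto
        have "c \<otimes> d0 = \<zero>" using cross True v_eq Fc by simp
        then have "c = \<zero>" using integral[of c d0] d0 u_eq v0_eq Fc by blast
        then have "c = (d \<otimes> inv d0) \<otimes> c0" using True i v_eq Fc by simp
        moreover have "d = (d \<otimes> inv d0) \<otimes> d0" using i v0_eq v_eq Fc by (simp add: m_assoc)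
        ultimately show ?thesis using F(8)[OF v_eq(1) i(1)] by blast
      qed
      then obtain s where s: "s \<in> F" "c = s \<otimes> c0" "d = s \<otimes> d0" by blast
      \<comment> \<open>Subtracting this multiple cancels the leading terms of \<open>u\<close> and
        of \<open>a \<otimes> u\<close> simultaneously.\<close>
      let ?w = "u \<ominus> s \<otimes> u0"
      have cc: "c0 \<in> carrier R" "d0 \<in> carrier R" "s \<in> carrier R" "p \<in> carrier R" "p0 \<in> carrier R"
        "r \<in> carrier R" "r0 \<in> carrier R" "x [^] j \<in> carrier R"
        using u0_eq v0_eq u_eq v_eq s Fc P_closed x by auto
      have w1: "?w = p \<ominus> s \<otimes> p0" unfolding u_eq(3) u0_eq(3) s(2) using cc by algebra
      have "a \<otimes> ?w = a \<otimes> u \<ominus> s \<otimes> (a \<otimes> u0)" using a uc u0c cc by algebra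
      also have "\<dots> = r \<ominus> s \<otimes> r0" unfolding v_eq(3) v0_eq(3) s(3) using cc by algebra
      finally have "?w \<in> W a j"
        using w1 P(5,6) u_eq v_eq u0_eq v0_eq s by (simp add: W_def)
      moreover have "u = s \<otimes> u0 \<oplus> ?w" using uc u0c cc by algebra
      ultimately show "u \<in> line_extension F u0 (W a j)"
        using s(1) unfolding line_extension_mem_iff by blast
    qed
  qed
  then show ?thesis using card_line_extension[OF subF WS u0c u0(2)] by simp
qed

section \<open>Double counting of scalars\<close>

text \<open>An ordered pair of nonzero elements \<open>u\<close>, \<open>v\<close> of
  \<open>P j\<close> arises from exactly one scalar, the quotient of \<open>v\<close> by
  \<open>u\<close>.\<close>

lemma sum_card_W:
  assumes t: "card K = card F ^ t" "j \<le> t"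
  shows "(\<Sum>a \<in> carrier R - {\<zero>}. card (W a j) - 1) = (card F ^ j - 1)\<^sup>2"
proof -
  let ?A = "SIGMA a : carrier R - {\<zero>}. W a j - {\<zero>}" and ?B = "P j - {\<zero>}"
  have "bij_betw (\<lambda>(a, u). (u, a \<otimes> u)) ?A (?B \<times> ?B)"
  proof (rule bij_betw_byWitness[where f' = "\<lambda>(u, v). (v \<otimes> inv u, u)"])
    have "a \<otimes> u \<otimes> inv u = a" if "a \<in> carrier R" "u \<in> P j" "u \<noteq> \<zero>" for a u
      using that P_closed[of u j] nonzero_inv[of u] by (simp add: m_assoc)
    then show "\<forall>y \<in> ?A. (case case y of (a, u) \<Rightarrow> (u, a \<otimes> u) of (u, v) \<Rightarrow> (v \<otimes> inv u, u)) = y"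
      by (auto simp: W_def)
    have vu: "v \<otimes> inv u \<otimes> u = v" if "v \<in> P j" "u \<in> P j" "u \<noteq> \<zero>" for v u
      using that P_closed[of u j] P_closed[of v j] nonzero_inv[of u] by (simp add: m_assoc)
    then show "\<forall>y \<in> ?B \<times> ?B. (case case y of (u, v) \<Rightarrow> (v \<otimes> inv u, u) of (a, u) \<Rightarrow> (u, a \<otimes> u)) = y"
      by auto
    have "a \<otimes> u \<noteq> \<zero>" if "a \<in> carrier R" "a \<noteq> \<zero>" "u \<in> P j" "u \<noteq> \<zero>" for a u
      using that integral[of a u] P_closed[of u j] by auto
    then show "(\<lambda>(a, u). (u, a \<otimes> u)) ` ?A \<subseteq> ?B \<times> ?B"
      by (auto simp: W_def)
    have "v \<otimes> inv u \<in> carrier R - {\<zero>}" if "v \<in> P j" "v \<noteq> \<zero>" "u \<in> P j" "u \<noteq> \<zero>" for v u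
      using that integral[of v "inv u"] P_closed[of u j] P_closed[of v j] nonzero_inv[of u] by auto
    then show "(\<lambda>(u, v). (v \<otimes> inv u, u)) ` (?B \<times> ?B) \<subseteq> ?A"
      using vu by (auto simp: W_def)
  qed
  then have "card ?A = card (?B \<times> ?B)" by (rule bij_betw_same_card)
  also have "\<dots> = (card F ^ j - 1)\<^sup>2"
    using card_P[OF t] P(2)[of j] finite_subalgebra[OF P_subalgebra[of j]]
    by (simp add: card_cartesian_product power2_eq_square)
  finally have "card ?A = (card F ^ j - 1)\<^sup>2" .
  moreover have fin: "finite (W a j)" if "a \<in> carrier R - {\<zero>}" for a
    using finite_subalgebra[OF W_subalgebra[of a j]] that by simp
  have "card ?A = (\<Sum>a \<in> carrier R - {\<zero>}. card (W a j - {\<zero>}))"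
    using finite_carrier fin by (intro card_SigmaI) simp_all
  moreover have "card (W a j - {\<zero>}) = card (W a j) - 1" if "a \<in> carrier R - {\<zero>}" for a
    using subalgebra_facts(2)[OF W_subalgebra[of a j]] fin[OF that] that by simp
  ultimately show ?thesis by simp
qed

text \<open>The elements counted here are the quotients of nonzero polynomials in \<open>x\<close> of degree at most
  \<open>j\<close>.\<close>

lemma card_W_nontrivial:
  assumes t: "card K = card F ^ t" "2 * j < t"
  shows "card {a \<in> carrier R - {\<zero>}. W a (Suc j) \<noteq> {\<zero>}} = card F ^ (2 * j + 1) - 1"
proof -
  let ?R = "carrier R - {\<zero>}" and ?q = "int (card F)"
  let ?C = "{a \<in> ?R. W a (Suc j) \<noteq> {\<zero>}}"
  have pos: "1 \<le> card (W a i)" if "a \<in> ?R" for a i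
  proof -
    have "W a i \<noteq> {}" "finite (W a i)"
      using that subalgebra_facts(2)[OF W_subalgebra[of a i]]
      finite_subalgebra[OF W_subalgebra[of a i]] by auto
    then show ?thesis by (simp add: Suc_leI card_gt_0_iff)
  qed
  \<comment> \<open>Pass to the integers, since the two sums are about to be subtracted from each
    other.\<close>
  have sum_int: "(\<Sum>a \<in> ?R. int (card (W a i)) - 1) = (?q ^ i - 1)\<^sup>2" if "i \<le> t" for i
  proof -
    have "int (\<Sum>a \<in> ?R. card (W a i) - 1) = (\<Sum>a \<in> ?R. int (card (W a i)) - 1)"
      unfolding of_nat_sum using pos by (intro sum.cong) (auto simp: of_nat_diff)
    moreover have "1 \<le> card F ^ i" using q_ge_2 by simp
    then have "int ((card F ^ i - 1)\<^sup>2) = (?q ^ i - 1)\<^sup>2" by (simp add: of_nat_diff)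
    ultimately show ?thesis unfolding sum_card_W[OF t(1) that] by (rule trans[OF sym])
  qed
  have sum_diff: "(\<Sum>a \<in> ?R. f a - ?q * g a) = sum f ?R - ?q * sum g ?R" for f g
    by (simp add: sum_subtractf sum_distrib_left)
  have "(?q ^ Suc j - 1)\<^sup>2 - ?q * (?q ^ j - 1)\<^sup>2
      = (\<Sum>a \<in> ?R. int (card (W a (Suc j))) - 1 - ?q * (int (card (W a j)) - 1))"
    using t(2) sum_int[of j] sum_int[of "Suc j"] sum_diff[of "\<lambda>a. int (card (W a (Suc j))) - 1"]
    by simp
  \<comment> \<open>If \<open>W a (Suc j)\<close> is nonzero, its size is \<open>?q\<close> times
    that of \<open>W a j\<close>, so the summand collapses to \<open>?q - 1\<close>; otherwise both
    spaces are zero and nothing remains.\<close>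
  also have "\<dots> = (\<Sum>a \<in> ?R. if W a (Suc j) \<noteq> {\<zero>} then ?q - 1 else 0)"
  proof (rule sum.cong[OF refl])
    fix a assume a: "a \<in> ?R"
    show "int (card (W a (Suc j))) - 1 - ?q * (int (card (W a j)) - 1)
        = (if W a (Suc j) \<noteq> {\<zero>} then ?q - 1 else 0)"
    proof (cases "W a (Suc j) = {\<zero>}")
      case True
      then have "W a j = {\<zero>}"
        using W_mono[of j "Suc j" a] subalgebra_facts(2)[OF W_subalgebra, of a j] a by auto
      then show ?thesis using True by simp
    next
      case False
      then show ?thesis using card_W_Suc[OF _ t False] a by (simp add: algebra_simps)
    qed
  qed
  also have "\<dots> = int (card ?C) * (?q - 1)"
  proof -
    have "?R \<inter> {a. W a (Suc j) \<noteq> {\<zero>}} = ?C" by blast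
    then show ?thesis using finite_carrier by (simp add: sum.If_cases)
  qed
  finally have sq: "(?q ^ Suc j - 1)\<^sup>2 - ?q * (?q ^ j - 1)\<^sup>2 = int (card ?C) * (?q - 1)" .
  \<comment> \<open>With \<open>z\<close> the field size and \<open>y\<close> its
    \<open>j\<close>-th power, this exposes the factor \<open>?q - 1\<close> to be
    cancelled.\<close>
  have "(z * y - 1)\<^sup>2 - z * (y - 1)\<^sup>2 = (z * (y * y) - 1) * (z - 1)" for y z :: int
    by (simp add: power2_eq_square algebra_simps)
  from this[of ?q "?q ^ j"] have "int (card ?C) * (?q - 1) = (?q ^ (2 * j + 1) - 1) * (?q - 1)"
    unfolding sq[symmetric] by (simp add: mult_2 power_add)
  then have "int (card ?C) = ?q ^ (2 * j + 1) - 1" using q_ge_2 by simp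
  then have "int (card ?C + 1) = int (card F ^ (2 * j + 1))" by simp
  then show ?thesis by (simp only: of_nat_eq_iff)
qed

text \<open>The dimension is 0 up to some index and then rises by one per step up to
  \<open>m\<close>, so the final size reveals the last index at which the space is zero. The bound
  \<open>2 * m \<le> t\<close> keeps every step within reach of \<open>card_W_Suc\<close>.\<close>

lemma card_W_eq_power_iff:
  assumes a: "a \<in> carrier R" and t: "card K = card F ^ t" "2 * m \<le> t" and i: "i < m"
  shows "card (W a m) = card F ^ (m - i) \<longleftrightarrow> W a (Suc i) \<noteq> {\<zero>} \<and> W a i = {\<zero>}"
proof -
  have grow: "card (W a m) = card F ^ (m - d)" if "d < m" "W a (Suc d) \<noteq> {\<zero>}" "W a d = {\<zero>}" for d
  proof -
    have step: "W a (d + Suc e) \<noteq> {\<zero>} \<and> card (W a (d + Suc e)) = card F ^ Suc e" if "d + Suc e \<le> m" for e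
      using that
    proof (induction e)
      case 0
      then show ?case
        using card_W_Suc[OF a t(1), of d] \<open>W a (Suc d) \<noteq> {\<zero>}\<close> \<open>W a d = {\<zero>}\<close> t(2) by simp
    next
      case (Suc e)
      let ?e = "d + Suc e"
      have IH: "W a ?e \<noteq> {\<zero>}" "card (W a ?e) = card F ^ Suc e" using Suc by auto
      have "\<zero> \<in> W a ?e" by (rule subalgebra_facts(2)[OF W_subalgebra[OF a]])
      then have ne: "W a (Suc ?e) \<noteq> {\<zero>}" using IH(1) W_mono[of ?e "Suc ?e" a] by auto
      then have "card (W a (Suc ?e)) = card F * card (W a ?e)"
        using Suc.prems t(2) by (intro card_W_Suc[OF a t(1)]) auto
      then show ?case using ne IH(2) by simp
    qed
    show ?thesis using step[of "m - Suc d"] \<open>d < m\<close> by (simp add: Suc_diff_Suc del: power_Suc)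
  qed
  show ?thesis
  proof
    assume eq: "card (W a m) = card F ^ (m - i)"
    moreover have "1 < card F ^ (m - i)" using q_ge_2 i by (intro one_less_power) auto
    ultimately have "W a m \<noteq> {\<zero>}" by auto
    \<comment> \<open>The first index with a nonzero space; it is a successor because
      \<open>W a 0\<close> is zero.\<close>
    define e where "e = (LEAST e. W a e \<noteq> {\<zero>})"
    have e: "W a e \<noteq> {\<zero>}" "e \<le> m"
      unfolding e_def using \<open>W a m \<noteq> {\<zero>}\<close> by (fact LeastI, fact Least_le)
    have before: "W a d = {\<zero>}" if "d < e" for d
      using not_less_Least[OF that[unfolded e_def]] by blast
    obtain d where d: "e = Suc d" using e(1) W_0[OF a] by (cases e) auto
    then have "card (W a m) = card F ^ (m - d)" using grow[of d] e before[of d] by simp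
    then have "m - d = m - i" using eq q_ge_2 by simp
    then have "d = i" using i d e(2) by simp
    then show "W a (Suc i) \<noteq> {\<zero>} \<and> W a i = {\<zero>}" using e d before[of d] by simp
  next
    assume "W a (Suc i) \<noteq> {\<zero>} \<and> W a i = {\<zero>}"
    then show "card (W a m) = card F ^ (m - i)" using grow[OF i] by simp
  qed
qed

end

section \<open>The orbit code of a hyperplane and a polynomial space\<close>

text \<open>\<open>Sb\<close> is a hyperplane over \<open>K\<close> with complementary line
  \<open>K b\<close>, and \<open>card_K\<close> says that \<open>K\<close> has degree
  \<open>2 * m\<close> over \<open>F\<close>.\<close>

locale hyperplane_code = finite_simple_extension +
  fixes Sb b m
  assumes Sb: "subalgebra K Sb R" and b: "b \<in> carrier R" "b \<notin> Sb"
    and hyperplane: "line_extension K b Sb = carrier R"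
    and card_K: "card K = card F ^ (2 * m)" and m_pos: "0 < m"
begin

definition S where "S = sum_set R Sb (scale_set R b (P m))"

lemmas Kf = subfield_facts[OF subK]
lemmas Sbf = subalgebra_facts[OF Sb]

lemma Sb_closed: "s \<in> Sb \<Longrightarrow> s \<in> carrier R"
  using Sbf(1) by blast

lemma K_closed: "k \<in> K \<Longrightarrow> k \<in> carrier R"
  using Kf(1) by blast

lemma P_K: "p \<in> P j \<Longrightarrow> p \<in> K"
  using P_subset_K by blast

section \<open>The space \<open>S\<close> and its decomposition along \<open>b\<close>\<close>

text \<open>Brings the elements of \<open>S\<close> into the shape used for line extensions, so that
  uniqueness of the coefficient of \<open>b\<close> applies.\<close>

lemma S_eq_image: "S = (\<lambda>(p, s). p \<otimes> b \<oplus> s) ` (P m \<times> Sb)"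
proof -
  have comm: "s \<oplus> b \<otimes> p = p \<otimes> b \<oplus> s" if "s \<in> Sb" "p \<in> P m" for s p
    using that Sb_closed[of s] P_closed[of p m] b(1) by (simp add: m_comm a_comm)
  show ?thesis
  proof (intro equalityI subsetI)
    fix y assume "y \<in> S"
    then obtain s p where "s \<in> Sb" "p \<in> P m" "y = s \<oplus> b \<otimes> p"
      unfolding S_def sum_set_def scale_set_def by blast
    then show "y \<in> (\<lambda>(p, s). p \<otimes> b \<oplus> s) ` (P m \<times> Sb)" using comm by auto
  next
    fix y assume "y \<in> (\<lambda>(p, s). p \<otimes> b \<oplus> s) ` (P m \<times> Sb)"
    then obtain s p where "s \<in> Sb" "p \<in> P m" "y = s \<oplus> b \<otimes> p" using comm by auto
    then show "y \<in> S" unfolding S_def sum_set_def scale_set_def by blast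
  qed
qed

lemma SE:
  assumes "y \<in> S"
  obtains p s where "p \<in> P m" "s \<in> Sb" "y = p \<otimes> b \<oplus> s"
  using assms by (auto simp: S_eq_image)

lemma SI: "p \<in> P m \<Longrightarrow> s \<in> Sb \<Longrightarrow> p \<otimes> b \<oplus> s \<in> S"
  by (auto simp: S_eq_image)

lemma S_subalgebra: "subalgebra F S R"
proof (rule subalgebraI)
  show "S \<subseteq> carrier R"
    using P_closed[of _ m] Sb_closed b(1) by (auto simp: S_eq_image)
  show "\<zero> \<in> S" using SI[OF P(2) Sbf(2)] b(1) by simp
next
  fix u v assume u: "u \<in> S" and v: "v \<in> S"
  obtain p s where ps: "p \<in> P m" "s \<in> Sb" "u = p \<otimes> b \<oplus> s" using u by (rule SE)
  obtain p' s' where ps': "p' \<in> P m" "s' \<in> Sb" "v = p' \<otimes> b \<oplus> s'" using v by (rule SE)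
  note h = ps(1,2) ps'(1,2) and uv = ps(3) ps'(3)
  have "u \<oplus> v = (p \<oplus> p') \<otimes> b \<oplus> (s \<oplus> s')"
    unfolding uv using h P_closed[of p m] P_closed[of p' m] Sb_closed[of s] Sb_closed[of s'] b(1)
    by (simp add: l_distr a_ac)
  then show "u \<oplus> v \<in> S" using SI[OF P(3)[OF h(1,3)] Sbf(3)[OF h(2,4)]] by simp
next
  fix c v assume c: "c \<in> F" and vS: "v \<in> S"
  obtain p s where h: "p \<in> P m" "s \<in> Sb" and v: "v = p \<otimes> b \<oplus> s" using vS by (rule SE)
  have cK: "c \<in> K" using c F_subset_K by blast
  have "c \<otimes> v = (c \<otimes> p) \<otimes> b \<oplus> c \<otimes> s"
    unfolding v using h K_closed[OF cK] P_closed[of p m] Sb_closed[of s] b(1)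
    by (simp add: r_distr m_assoc)
  then show "c \<otimes> v \<in> S" using SI[OF P(6)[OF c h(1)] Sbf(6)[OF cK h(2)]] by simp
qed (use F(1,4) in auto)

lemmas Sf = subalgebra_facts[OF S_subalgebra]

lemma decomposition_unique:
  assumes "k \<in> K" "k' \<in> K" "s \<in> Sb" "s' \<in> Sb" "k \<otimes> b \<oplus> s = k' \<otimes> b \<oplus> s'"
  shows "k = k'" "s = s'"
  using line_coeff_unique[OF subK Sb b assms] by blast+

lemma card_S: "card S = card F ^ m * card Sb"
proof -
  have "inj_on (\<lambda>(p, s). p \<otimes> b \<oplus> s) (P m \<times> Sb)"
  proof (rule inj_onI)
    fix y z assume "y \<in> P m \<times> Sb" "z \<in> P m \<times> Sb"
      and "(case y of (p, s) \<Rightarrow> p \<otimes> b \<oplus> s) = (case z of (p, s) \<Rightarrow> p \<otimes> b \<oplus> s)"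
    then show "y = z"
      using decomposition_unique[of "fst y" "fst z" "snd y" "snd z"] P_K[of _ m]
      by (simp add: case_prod_beta mem_Times_iff prod_eq_iff)
  qed
  then have "card S = card (P m \<times> Sb)" unfolding S_eq_image by (rule card_image)
  then show ?thesis using card_P[OF card_K, of m] by (simp add: card_cartesian_product)
qed

lemma card_carrier: "card (carrier R) = card F ^ (2 * m) * card Sb"
  using card_line_extension[OF subK Sb b] hyperplane card_K by simp

section \<open>Intersections of \<open>S\<close> with its scaled copies\<close>

text \<open>Scaling by \<open>a\<close> preserves \<open>Sb\<close>, so membership in both spaces is
  a condition on the coefficient of \<open>b\<close> alone: it must be \<open>a \<otimes> p\<close>
  with \<open>p\<close> in \<open>W a m\<close>.\<close>

lemma card_inter_in_K:
  assumes a: "a \<in> K" "a \<noteq> \<zero>"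
  shows "card (S \<inter> scale_set R a S) = card (W a m) * card Sb"
proof -
  let ?f = "\<lambda>(p, s). (a \<otimes> p) \<otimes> b \<oplus> s"
  have ac: "a \<in> carrier R" by (rule K_closed[OF a(1)])
  have "S \<inter> scale_set R a S = ?f ` (W a m \<times> Sb)"
  proof (intro equalityI subsetI)
    fix y assume y: "y \<in> S \<inter> scale_set R a S"
    then obtain p s where ps: "p \<in> P m" "s \<in> Sb" "y = p \<otimes> b \<oplus> s" using SE[of y] by blast
    obtain z where z: "z \<in> S" "y = a \<otimes> z" using y unfolding scale_set_def by blast
    obtain p' s' where ps': "p' \<in> P m" "s' \<in> Sb" "z = p' \<otimes> b \<oplus> s'" using z(1) by (rule SE)
    have "y = (a \<otimes> p') \<otimes> b \<oplus> a \<otimes> s'"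
      unfolding z(2) ps'(3) using ps' ac P_closed[of p' m] Sb_closed[of s'] b(1)
      by (simp add: r_distr m_assoc)
    then have "p = a \<otimes> p'"
      using decomposition_unique(1)[OF P_K[OF ps(1)] Kf(8)[OF a(1) P_K[OF ps'(1)]] ps(2)
          Sbf(6)[OF a(1) ps'(2)]] ps(3) by simp
    then show "y \<in> ?f ` (W a m \<times> Sb)" using ps ps'(1) by (auto simp: W_def)
  next
    fix y assume "y \<in> ?f ` (W a m \<times> Sb)"
    then obtain p s where ps: "p \<in> P m" "a \<otimes> p \<in> P m" "s \<in> Sb" "y = (a \<otimes> p) \<otimes> b \<oplus> s"
      by (auto simp: W_def)
    \<comment> \<open>The component in \<open>Sb\<close> can be divided by \<open>a\<close>, which
      exhibits \<open>y\<close> as a multiple of an element of \<open>S\<close>.\<close>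
    have s': "inv a \<otimes> s \<in> Sb" by (rule Sbf(6)[OF Kf(9)[OF a] ps(3)])
    have "a \<otimes> (inv a \<otimes> s) = s"
      using nonzero_inv[OF ac a(2)] ac Sb_closed[OF ps(3)] by (simp add: m_assoc[symmetric])
    then have "y = a \<otimes> (p \<otimes> b \<oplus> inv a \<otimes> s)"
      using ps(4) ac b(1) P_closed[OF ps(1)] Sb_closed[OF s'] by (simp add: r_distr m_assoc)
    then have "y \<in> scale_set R a S" using SI[OF ps(1) s'] by (simp add: scale_set_def)
    then show "y \<in> S \<inter> scale_set R a S" using SI[OF ps(2,3)] ps(4) by simp
  qed
  moreover have "inj_on ?f (W a m \<times> Sb)"
  proof (rule inj_onI)
    fix y z assume y: "y \<in> W a m \<times> Sb" and z: "z \<in> W a m \<times> Sb" and eq: "?f y = ?f z"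
    obtain p s where y': "y = (p, s)" "p \<in> P m" "a \<otimes> p \<in> P m" "s \<in> Sb" using y by (auto simp: W_def)
    obtain p' s' where z': "z = (p', s')" "p' \<in> P m" "a \<otimes> p' \<in> P m" "s' \<in> Sb"
      using z by (auto simp: W_def)
    have "a \<otimes> p = a \<otimes> p'" "s = s'"
      using decomposition_unique[OF P_K[OF y'(3)] P_K[OF z'(3)] y'(4) z'(4)] eq y'(1) z'(1) by auto
    then show "y = z"
      using m_lcancel[OF a(2) ac P_closed[OF y'(2)] P_closed[OF z'(2)]] y'(1) z'(1) by simp
  qed
  ultimately show ?thesis by (simp add: card_image card_cartesian_product)
qed

text \<open>Such an \<open>a\<close> is a quotient of two elements of \<open>P j\<close>, hence of
  \<open>K\<close>.\<close>

lemma in_K_if_W_nontrivial: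
  assumes "a \<in> carrier R" "W a j \<noteq> {\<zero>}"
  shows "a \<in> K"
proof -
  obtain u where u: "u \<in> P j" "a \<otimes> u \<in> P j" "u \<noteq> \<zero>"
    using assms subalgebra_facts(2)[OF W_subalgebra[OF assms(1)], of j] by (auto simp: W_def)
  have "a \<otimes> u \<otimes> inv u \<in> K" by (rule Kf(8)[OF P_K[OF u(2)] Kf(9)[OF P_K[OF u(1)] u(3)]])
  then show ?thesis
    using nonzero_inv[OF P_closed[OF u(1)] u(3)] P_closed[OF u(1)] assms(1) by (simp add: m_assoc)
qed

text \<open>A stabiliser \<open>a\<close> of the hyperplane acts on the one-dimensional quotient as some \<open>k\<close> in \<open>K\<close>;
  if $a \neq k$, then $a - k$ would be an automorphism of the hyperplane sending \<open>b\<close> into it.\<close>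

lemma hyperplane_not_stable:
  assumes a: "a \<in> carrier R" "a \<notin> K"
  shows "\<exists>s \<in> Sb. a \<otimes> s \<notin> Sb"
proof (rule ccontr)
  assume "\<not> ?thesis"
  then have stable: "a \<otimes> s \<in> Sb" if "s \<in> Sb" for s using that by blast
  have "a \<otimes> b \<in> line_extension K b Sb" using a b hyperplane by simp
  then obtain k s where ks: "k \<in> K" "s \<in> Sb" "a \<otimes> b = k \<otimes> b \<oplus> s"
    by (auto simp: line_extension_mem_iff)
  have kc: "k \<in> carrier R" "s \<in> carrier R" using ks K_closed Sb_closed by auto
  let ?c = "a \<ominus> k"
  have c: "?c \<in> carrier R" "?c \<noteq> \<zero>" using a ks(1) kc by (auto simp: r_right_minus_eq)
  have "?c \<otimes> b = a \<otimes> b \<ominus> k \<otimes> b" using a kc b(1) by algebra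
  also have "\<dots> = s" unfolding ks(3) using kc b(1) by algebra
  finally have cb: "?c \<otimes> b = s" .
  have "scale_set R ?c Sb \<subseteq> Sb"
  proof
    fix y assume "y \<in> scale_set R ?c Sb"
    then obtain v where v: "v \<in> Sb" "y = ?c \<otimes> v" unfolding scale_set_def by blast
    have "y = a \<otimes> v \<ominus> k \<otimes> v" unfolding v(2) using a kc Sb_closed[OF v(1)] by algebra
    then show "y \<in> Sb" using Sbf(5)[OF stable[OF v(1)] Sbf(6)[OF ks(1) v(1)]] by simp
  qed
  \<comment> \<open>\<open>?c\<close> maps \<open>Sb\<close> onto itself, so \<open>s\<close> has a
    preimage in \<open>Sb\<close>; but \<open>b\<close> is its only preimage.\<close>
  then have "s \<in> scale_set R ?c Sb" using scale_set_eq[OF Sbf(1) c] ks(2) by simp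
  then obtain v where v: "v \<in> Sb" "s = ?c \<otimes> v" unfolding scale_set_def by blast
  then have "b = v" using cb m_lcancel[OF c(2,1) b(1) Sb_closed[OF v(1)]] by simp
  then show False using b(2) v(1) by simp
qed

lemma card_Sb_pos: "0 < card Sb"
  using Sbf(2) finite_subalgebra[OF Sb] by (auto simp: card_gt_0_iff)

text \<open>Two distinct hyperplanes span everything, so the dimension formula determines the
  intersection, and \<open>W a m\<close> is zero.\<close>

lemma card_inter_not_in_K:
  assumes a: "a \<in> carrier R" "a \<notin> K"
  shows "card (S \<inter> scale_set R a S) = card (W a m) * card Sb"
proof -
  have az: "a \<noteq> \<zero>" using a(2) Kf(2) by blast
  let ?T = "Sb <+>\<^bsub>R\<^esub> scale_set R a Sb"
  have Tm: "u \<oplus> v \<in> ?T" if "u \<in> Sb" "v \<in> scale_set R a Sb" for u v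
    using that unfolding set_add_def' by blast
  note aSb = scale_set_subalgebra[OF subK Sb a(1)]
  have T: "subalgebra K ?T R"
    by (rule finite_dimension_imp_subalgebra[OF subK sum_space_dim(1)[OF subK
          subalgebra_finite_dimension[OF subK Sb] subalgebra_finite_dimension[OF subK aSb]]])
  note Tf = subalgebra_facts[OF T]
  \<comment> \<open>The coefficient \<open>k\<close> of \<open>b\<close> in
    \<open>a \<otimes> s\<close> is nonzero, so \<open>b\<close> can be solved for inside
    \<open>?T\<close>; with \<open>Sb\<close> it then generates the whole field.\<close>
  obtain s where s: "s \<in> Sb" "a \<otimes> s \<notin> Sb" using hyperplane_not_stable[OF a] by blast
  have sc: "s \<in> carrier R" by (rule Sb_closed[OF s(1)])
  have "a \<otimes> s \<in> line_extension K b Sb" using a sc hyperplane by simp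
  then obtain k s' where ks: "k \<in> K" "s' \<in> Sb" "a \<otimes> s = k \<otimes> b \<oplus> s'"
    by (auto simp: line_extension_mem_iff)
  have kc: "k \<in> carrier R" "s' \<in> carrier R" using ks K_closed Sb_closed by auto
  have kz: "k \<noteq> \<zero>" using s(2) ks(2,3) kc b(1) by auto
  have "\<ominus> s' \<oplus> a \<otimes> s \<in> ?T" using Sbf(4)[OF ks(2)] s(1) by (intro Tm) (auto simp: scale_set_def)
  moreover have "\<ominus> s' \<oplus> a \<otimes> s = k \<otimes> b" unfolding ks(3) using kc b(1) by algebra
  ultimately have "inv k \<otimes> (k \<otimes> b) \<in> ?T" using Tf(6)[OF Kf(9)[OF ks(1) kz]] by simp
  then have bT: "b \<in> ?T" using nonzero_inv[OF kc(1) kz] kc b(1) by (simp add: m_assoc[symmetric])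
  have SbT: "u \<in> ?T" if "u \<in> Sb" for u
    using Tm[OF that subalgebra_facts(2)[OF aSb]] Sb_closed[OF that] by simp
  have carrier_T: "carrier R \<subseteq> ?T"
  proof
    fix y assume "y \<in> carrier R"
    then obtain k u where "k \<in> K" "u \<in> Sb" "y = k \<otimes> b \<oplus> u"
      unfolding hyperplane[symmetric] line_extension_mem_iff by blast
    then show "y \<in> ?T" using Tf(3)[OF Tf(6)[OF _ bT] SbT] by simp
  qed
  have SbS: "Sb \<subseteq> S"
  proof
    fix u assume u: "u \<in> Sb"
    then show "u \<in> S" using SI[OF P(2) u] Sb_closed b(1) by simp
  qed
  then have T_sum: "?T \<subseteq> S <+>\<^bsub>R\<^esub> scale_set R a S"
    unfolding set_add_def' scale_set_def by blast
  have "S <+>\<^bsub>R\<^esub> scale_set R a S \<subseteq> carrier R"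
    using Sf(1) a(1) by (intro set_add_closed) (auto simp: scale_set_def)
  then have "S <+>\<^bsub>R\<^esub> scale_set R a S = carrier R"
    using subset_trans[OF carrier_T T_sum] by (rule equalityI)
  then have "card S * card S = card (carrier R) * card (S \<inter> scale_set R a S)"
    using card_Int_set_add[OF subF S_subalgebra scale_set_subalgebra[OF subF S_subalgebra a(1)]]
    by (simp add: card_scale_set[OF Sf(1) a(1) az])
  \<comment> \<open>Here the degree \<open>2 * m\<close> of \<open>K\<close> matters: the square of
    \<open>card S\<close> is exactly \<open>card (carrier R)\<close> times
    \<open>card Sb\<close>.\<close>
  moreover have "card S * card S = (card F ^ (2 * m) * card Sb) * card Sb"
    unfolding card_S power_even_eq power2_eq_square by (simp only: mult_ac)
  ultimately have eq: "(card F ^ (2 * m) * card Sb) * card (S \<inter> scale_set R a S)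
      = (card F ^ (2 * m) * card Sb) * card Sb"
    unfolding card_carrier by (rule trans[OF sym])
  have "card F ^ (2 * m) * card Sb \<noteq> 0" using card_Sb_pos q_ge_2 by simp
  then have "card (S \<inter> scale_set R a S) = card Sb" using eq by (simp only: mult_cancel1 simp_thms)
  moreover have "W a m = {\<zero>}" using in_K_if_W_nontrivial[OF a(1)] a(2) by blast
  ultimately show ?thesis by simp
qed

lemma card_inter:
  "a \<in> carrier R - {\<zero>} \<Longrightarrow> card (S \<inter> scale_set R a S) = card (W a m) * card Sb"
  using card_inter_in_K card_inter_not_in_K by (cases "a \<in> K") auto

section \<open>Stabiliser and weights\<close>

text \<open>A full intersection is the case of index 0 of the growth pattern, so
  \<open>W a 1\<close> is nonzero; as \<open>P 1\<close> consists of scalars, \<open>a\<close> is a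
  quotient of elements of \<open>F\<close>.\<close>

lemma stabiliser:
  assumes a: "a \<in> carrier R - {\<zero>}"
  shows "scale_set R a S = S \<longleftrightarrow> a \<in> F"
proof
  assume "scale_set R a S = S"
  then have "card (W a m) * card Sb = card S" using card_inter[OF a] by simp
  then have "card (W a m) * card Sb = card F ^ (m - 0) * card Sb" unfolding card_S by simp
  then have "card (W a m) = card F ^ (m - 0)" using card_Sb_pos by simp
  then have "W a (Suc 0) \<noteq> {\<zero>}"
    using card_W_eq_power_iff[OF _ card_K _ m_pos, of a] a by simp
  then obtain u where u: "u \<in> P (Suc 0)" "a \<otimes> u \<in> P (Suc 0)" "u \<noteq> \<zero>"
    using a subalgebra_facts(2)[OF W_subalgebra[of a], of "Suc 0"] by (auto simp: W_def)
  have P1: "y \<in> F" if y: "y \<in> P (Suc 0)" for y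
  proof -
    obtain c p where "c \<in> F" "p \<in> P 0" "y = c \<otimes> x [^] (0::nat) \<oplus> p" using y by (rule P_SucE)
    then show ?thesis using F(1) by (auto simp: subset_iff)
  qed
  have "a \<otimes> u \<otimes> inv u \<in> F" by (rule F(8)[OF P1[OF u(2)] F(9)[OF P1[OF u(1)] u(3)]])
  then show "a \<in> F"
    using nonzero_inv[OF P_closed[OF u(1)] u(3)] P_closed[OF u(1)] a by (simp add: m_assoc)
next
  assume "a \<in> F"
  then have "scale_set R a S \<subseteq> S" using Sf(6) by (auto simp: scale_set_def)
  then show "scale_set R a S = S" using a by (intro scale_set_eq[OF Sf(1)]) auto
qed

text \<open>\<open>Sb\<close> contributes equally to \<open>S\<close> and to the intersection and
  cancels, leaving twice the codimension of \<open>W a m\<close> in dimension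
  \<open>m\<close>.\<close>

lemma subspace_dist_iff:
  assumes a: "a \<in> carrier R - {\<zero>}" and i: "i \<le> m"
  shows "subspace_dist R F S (scale_set R a S) = 2 * i \<longleftrightarrow> card (W a m) = card F ^ (m - i)"
proof -
  have ac: "a \<in> carrier R" using a by simp
  note SbF = subalgebra_K_imp_F[OF Sb] and WF = W_subalgebra[OF ac, of m]
  let ?D = "dim F Sb" and ?w = "dim F (W a m)"
  have cSb: "card Sb = card F ^ ?D" and cW: "card (W a m) = card F ^ ?w"
    using card_subalgebra[OF subF] SbF WF by auto
  have inter: "subalgebra F (S \<inter> scale_set R a S) R"
    by (rule subalgebra_inter[OF S_subalgebra scale_set_subalgebra[OF subF S_subalgebra ac]])
  have "dim F S = m + ?D"
    by (rule dim_eqI[OF subF S_subalgebra]) (simp add: card_S cSb power_add)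
  moreover have "dim F (S \<inter> scale_set R a S) = ?w + ?D"
    by (rule dim_eqI[OF subF inter]) (simp add: card_inter[OF a] cW cSb power_add)
  ultimately have dist: "subspace_dist R F S (scale_set R a S) = 2 * (m - ?w)"
    by (simp add: subspace_dist_def)
  \<comment> \<open>Needed so that \<open>m - ?w\<close> is a true difference and determines
    \<open>?w\<close>.\<close>
  have "card (W a m) \<le> card (P m)"
    by (intro card_mono finite_subalgebra[OF P_subalgebra]) (auto simp: W_def)
  then have "card F ^ ?w \<le> card F ^ m" using cW card_P_le[of m] by simp
  then have "?w \<le> m" using q_ge_2 by simp
  then show ?thesis unfolding dist cW using i q_ge_2 by auto
qed

lemma omega_eq:
  assumes "i \<le> m"
  shows "(card F - 1) * omega R F S i
    = card {a \<in> carrier R - {\<zero>}. card (W a m) = card F ^ (m - i)}"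
proof -
  have "{a \<in> carrier R - {\<zero>}. subspace_dist R F S (scale_set R a S) = 2 * i}
      = {a \<in> carrier R - {\<zero>}. card (W a m) = card F ^ (m - i)}"
    using subspace_dist_iff[OF _ assms] by blast
  then show ?thesis
    using card_orbit_fibres[OF subF Sf(1) stabiliser, of "\<lambda>V. subspace_dist R F S V = 2 * i"]
    by (simp add: omega_def)
qed

text \<open>Distance \<open>2 * i\<close> means that index \<open>i\<close> is the last one with a
  zero space. The counts for \<open>i + 1\<close> and \<open>i\<close> differ by
  \<open>q^(2i+1) - q^(2i-1)\<close>, where \<open>q\<close> is \<open>card F\<close>, and this
  equals \<open>(q - 1)(q + 1) q^(2i-1)\<close>.\<close>

lemma omega_less:
  assumes i: "1 \<le> i" "i < m"
  shows "omega R F S i = (card F + 1) * card F ^ (2 * i - 1)"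
proof -
  let ?N = "\<lambda>j. {a \<in> carrier R - {\<zero>}. W a (Suc j) \<noteq> {\<zero>}}"
  obtain j where j: "i = Suc j" using i by (cases i) auto
  have zero: "\<zero> \<in> W a j" if "a \<in> carrier R" for a j
    by (rule subalgebra_facts(2)[OF W_subalgebra[OF that]])
  have "{a \<in> carrier R - {\<zero>}. card (W a m) = card F ^ (m - i)} = ?N i - ?N j"
    using card_W_eq_power_iff[OF _ card_K _ i(2)] j by auto
  moreover have "?N j \<subseteq> ?N i"
  proof
    fix a assume "a \<in> ?N j"
    then have "a \<in> carrier R - {\<zero>}" "W a (Suc j) \<noteq> {\<zero>}" by auto
    then show "a \<in> ?N i" using W_mono[of "Suc j" "Suc i" a] zero[of a "Suc j"] j by auto
  qed
  moreover have "finite (?N j)" using finite_carrier by simp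
  ultimately have "(card F - 1) * omega R F S i = card (?N i) - card (?N j)"
    using omega_eq[of i] i by (simp add: card_Diff_subset)
  moreover have "card (?N i) = card F ^ (2 * i + 1) - 1"
    by (rule card_W_nontrivial[OF card_K]) (use i in simp)
  moreover have "card (?N j) = card F ^ (2 * i - 1) - 1"
    using card_W_nontrivial[OF card_K, of j] i j by simp
  ultimately have *: "(card F - 1) * omega R F S i
      = (card F ^ (2 * i + 1) - 1) - (card F ^ (2 * i - 1) - 1)" by (simp only:)
  have pw: "card F ^ (2 * i + 1) = card F * (card F * card F ^ (2 * i - 1))"
    using i by (cases i) auto
  have "int ((card F - 1) * omega R F S i)
      = int ((card F - 1) * ((card F + 1) * card F ^ (2 * i - 1)))"
  proof -
    have "1 \<le> card F ^ (2 * i - 1)" "card F ^ (2 * i - 1) \<le> card F ^ (2 * i + 1)"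
      using q_ge_2 by (auto intro!: power_increasing simp del: power_Suc)
    then have "int ((card F - 1) * omega R F S i)
        = int (card F ^ (2 * i + 1)) - int (card F ^ (2 * i - 1))"
      unfolding * by linarith
    moreover have "int (card F - 1) = int (card F) - 1" using q_ge_2 by simp
    ultimately show ?thesis unfolding pw by (simp add: algebra_simps)
  qed
  then show ?thesis using q_ge_2 unfolding of_nat_eq_iff by simp
qed

text \<open>Distance \<open>2 * m\<close> occurs exactly when \<open>W a m\<close> is zero, so the
  count is complementary to \<open>card_W_nontrivial\<close>; the two excluded zeros cancel.\<close>

lemma omega_top:
  "(card F - 1) * omega R F S m = card (carrier R) - card F ^ (2 * m - 1)"
proof -
  obtain j where j: "m = Suc j" using m_pos by (cases m) auto
  let ?N = "{a \<in> carrier R - {\<zero>}. W a (Suc j) \<noteq> {\<zero>}}"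
  have "card (W a m) = 1 \<longleftrightarrow> W a (Suc j) = {\<zero>}" if "a \<in> carrier R - {\<zero>}" for a
    using subalgebra_facts(2)[OF W_subalgebra[of a m]] that j by (auto simp: card_1_singleton_iff)
  then have "{a \<in> carrier R - {\<zero>}. card (W a m) = card F ^ (m - m)} = (carrier R - {\<zero>}) - ?N"
    by auto
  moreover have "card ((carrier R - {\<zero>}) - ?N) = card (carrier R - {\<zero>}) - card ?N"
    using finite_carrier by (intro card_Diff_subset) auto
  ultimately have "(card F - 1) * omega R F S m = card (carrier R - {\<zero>}) - card ?N"
    using omega_eq[of m] by (simp only: order_refl)
  moreover have "card ?N = card F ^ (2 * m - 1) - 1"
    using card_W_nontrivial[OF card_K, of j] j by simp
  moreover have "1 \<le> card F ^ (2 * m - 1)" using q_ge_2 by simp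
  ultimately show ?thesis using finite_carrier by simp
qed

end

section \<open>The weight distribution of the given code\<close>

theorem theorem4p11:
  fixes R :: "('a, 'b) ring_scheme"
    and F :: "'a set" and q n :: nat
    and lam b :: 'a and Sbar S :: "'a set" and t l m k r :: nat
  assumes field: "field R"
    and fin: "finite (carrier R)"
    and subF: "subfield F R"
    and cardF: "card F = q"
    and cardR: "card (carrier R) = q ^ n"
    and lam: "lam \<in> carrier R - F"
    and t_def: "t = ring.dim R F (generate_field R (insert lam F))"
    and Sbar_sub: "subalgebra (generate_field R (insert lam F)) Sbar R"
    and Sbar_dim: "ring.dim R (generate_field R (insert lam F)) Sbar = l"
    and l_pos: "l > 0"
    and b: "b \<in> carrier R - {\<zero>\<^bsub>R\<^esub>}"
    and b_int: "generate_field R (insert lam F) \<inter> scale_set R b Sbar = {\<zero>\<^bsub>R\<^esub>}"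
    and m_pos: "0 < m" and m_lt: "m < t"
    and k_def: "k = t * l + m"
    and k_lo: "t + 1 \<le> k" and k_hi: "k \<le> n"
    and S_def: "S = sum_set R Sbar (scale_set R b (ring.Span R F (map (\<lambda>j. lam [^]\<^bsub>R\<^esub> j) [0..<m])))"
    and direct: "Sbar \<inter> scale_set R b (ring.Span R F (map (\<lambda>j. lam [^]\<^bsub>R\<^esub> j) [0..<m])) = {\<zero>\<^bsub>R\<^esub>}"
    and Y: "span_set R (generate_field R (insert lam F)) S = carrier R"
    and m_ge: "2 * m \<ge> t - 1"
    and r_def: "r = 2 * m + t * (l - 1)"
    and FWS: "is_FWS R F S r"
    and r_eq: "r = t * l"
  shows "(\<forall>i \<in> {1..m - 1}. omega R F S i = (q + 1) * q ^ (2 * i - 1)) \<and>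
         real (omega R F S m) = (real q ^ n - real q ^ (2 * m - 1)) / (real q - 1)"
proof -
  interpret finite_simple_extension R F lam
    by (intro finite_simple_extension.intro finite_field.intro finite_field_axioms.intro
        finite_simple_extension_axioms.intro field fin subF) (use lam in simp)
  \<comment> \<open>Equating the two expressions for \<open>r\<close> and cancelling
    \<open>t * (l - 1)\<close>, with \<open>l\<close> positive.\<close>
  have t: "t = 2 * m" using r_def r_eq l_pos by (cases l) auto
  have cK: "card K = card F ^ (2 * m)"
    using card_subalgebra[OF subF subalgebra_K_imp_F[OF subfield_subalgebra[OF subK]]] t_def t by simp
  have S_P: "S = sum_set R Sbar (scale_set R b (P m))" using S_def by (simp add: P_def)
  have bc: "b \<in> carrier R" using b by simp
  \<comment> \<open>As \<open>m\<close> is positive, \<open>b\<close> itself lies in the second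
    summand of \<open>S\<close>; directness of the sum then keeps it out of
    \<open>Sbar\<close>.\<close>
  have "b \<otimes>\<^bsub>R\<^esub> \<one>\<^bsub>R\<^esub> \<in> scale_set R b (P m)"
    using one_in_P[OF m_pos] by (simp add: scale_set_def)
  then have b_notin: "b \<notin> Sbar" using direct b by (auto simp: P_def)
  \<comment> \<open>This space contains \<open>S\<close>, so by minimality of the span it contains
    the whole field: \<open>Sbar\<close> is a hyperplane.\<close>
  have "subalgebra K (line_extension K b Sbar) R"
    by (rule line_extension_subalgebra[OF subK Sbar_sub bc])
  moreover have "S \<subseteq> line_extension K b Sbar"
  proof
    fix y assume "y \<in> S"
    then obtain s p where sp: "s \<in> Sbar" "p \<in> P m" "y = s \<oplus>\<^bsub>R\<^esub> b \<otimes>\<^bsub>R\<^esub> p"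
      unfolding S_P sum_set_def scale_set_def by blast
    have "s \<in> carrier R" "p \<in> carrier R"
      using subalgebra_facts(1)[OF Sbar_sub] sp(1) P_closed[OF sp(2)] by auto
    then have "y = p \<otimes>\<^bsub>R\<^esub> b \<oplus>\<^bsub>R\<^esub> s" using sp(3) bc by (simp add: m_comm a_comm)
    then show "y \<in> line_extension K b Sbar"
      using sp P_subset_K[of m] by (auto simp: line_extension_mem_iff)
  qed
  ultimately have "carrier R \<subseteq> line_extension K b Sbar"
    unfolding Y[symmetric] span_set_def by blast
  then have "line_extension K b Sbar = carrier R"
    using subalgebra_facts(1)[OF line_extension_subalgebra[OF subK Sbar_sub bc]] by blast
  then interpret C: hyperplane_code R F lam Sbar b m
    by (intro hyperplane_code.intro hyperplane_code_axioms.intro finite_simple_extension_axioms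
        Sbar_sub bc b_notin cK m_pos)
  have S_C: "C.S = S" using S_P by (simp add: C.S_def)
  have "omega R F S i = (q + 1) * q ^ (2 * i - 1)" if "i \<in> {1..m - 1}" for i
    using C.omega_less[of i] that m_pos cardF S_C by auto
  moreover have "real (omega R F S m) = (real q ^ n - real q ^ (2 * m - 1)) / (real q - 1)"
  proof -
    have q: "2 \<le> q" using q_ge_2 cardF by simp
    \<comment> \<open>Guarantees that the natural-number subtraction agrees with the real
      one.\<close>
    have "q ^ (2 * m - 1) \<le> q ^ (2 * m) * card Sbar"
    proof -
      have "q ^ (2 * m - 1) \<le> q ^ (2 * m)" using q by (intro power_increasing) auto
      also have "\<dots> \<le> q ^ (2 * m) * card Sbar" using C.card_Sb_pos by simp
      finally show ?thesis .
    qed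
    then have le: "q ^ (2 * m - 1) \<le> q ^ n" using C.card_carrier cardR cardF by simp
    have "(q - 1) * omega R F S m = q ^ n - q ^ (2 * m - 1)"
      using C.omega_top cardR cardF S_C by simp
    then have "real ((q - 1) * omega R F S m) = real (q ^ n - q ^ (2 * m - 1))" by (rule arg_cong)
    then have "(real q - 1) * real (omega R F S m) = real q ^ n - real q ^ (2 * m - 1)"
      using q le by (simp add: of_nat_diff)
    then show ?thesis using q by (simp add: field_simps)
  qed
  ultimately show ?thesis by blast
qed

end
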